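(* Let $n\ge 1$ and let $A$ and $B$ be centered ellipsoids in $\mathbb{R}^n$ (in arbitrary position relative to each other). Then $$\mu_n(A\cap B)\ \ge\ \mu_n(A)\,\mu_n(B).$$
   Context: $\mu_n$ denotes the standard Gaussian measure on $\mathbb{R}^n$, $\mu_n(A)=(2\pi)^{-n/2}\int_A e^{-|x|^2/2}\,dx$, where $|\cdot|$ is the Euclidean norm. A centered ellipsoid is the image of the closed Euclidean unit ball $\{x\in\mathbb{R}^n:|x|\le 1\}$ under an invertible linear map of $\mathbb{R}^n$; equivalently, a set of the form $U(\{x:\sum_{i=1}^n x_i^2/r_i^2\le 1\})$ with $U$ an orthogonal matrix and $r_1,\dots,r_n>0$. *)

theory Defs
  imports "HOL-Analysis.Analysis"
begin

definition std_gaussian :: "'a::euclidean_space measure" where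
  "std_gaussian =
     density lborel
       (\<lambda>x. ennreal ((2 * pi) powr (- real DIM('a) / 2) * exp (- (norm x)\<^sup>2 / 2)))"

definition centered_ellipsoid :: "'a::euclidean_space set \<Rightarrow> bool" where
  "centered_ellipsoid A \<longleftrightarrow> (\<exists>f :: 'a \<Rightarrow> 'a. linear f \<and> bij f \<and> A = f ` cball 0 1)"

end

theory Submission
  imports Defs "HOL-Probability.Distributions" "HOL-Real_Asymp.Real_Asymp"
begin

text \<open>
  Write \<open>A = {q \<le> 1}\<close> and \<open>B = {p \<le> 1}\<close> with positive definite quadratic forms \<open>q\<close>, \<open>p\<close>, and replace both
  indicators by \<open>\<phi>(q)\<close>, \<open>\<phi>(p)\<close> with a smooth strictly decreasing \<open>\<phi>\<close>. Diagonalise \<open>p\<close> and choose an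
  orthogonal \<open>U\<close> minimising \<open>\<integral> \<phi>(q \<circ> U) \<phi>(p) d\<mu>\<close>; the product of the two separate integrals does not depend on \<open>U\<close>.
  At the minimum the derivatives along rotations in coordinate planes vanish, so that
  \<open>\<integral> \<phi>(q) \<phi>'(p) Z d\<mu> = 0\<close>, where \<open>Z\<close> is the off-diagonal part of \<open>q\<close> (now standing for \<open>q \<circ> U\<close>). By symmetry under
  sign changes of single coordinates the same holds with \<open>\<phi>(q - Z)\<close> in place of \<open>\<phi>(q)\<close>. Since \<open>\<phi>\<close> is
  decreasing, \<open>(\<phi>(q - Z) - \<phi>(q)) Z \<ge> 0\<close>, and \<open>\<phi>' < 0\<close>, so \<open>Z = 0\<close>: the minimum is attained at coaxial
  ellipsoids. There both functions are decreasing in every \<open>\<bar>x\<^sub>i\<bar>\<close> and Harris' inequality for product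
  measures applies.
\<close>

subsection \<open>The standard Gaussian measure\<close>

text \<open>Writing the density as a product of one-dimensional normal densities reduces the total
  mass to the known integral on the line.\<close>

lemma std_gaussian_alt:
  "(std_gaussian :: 'a::euclidean_space measure) =
     density lborel (\<lambda>x. \<Prod>b\<in>Basis. ennreal (std_normal_density (x \<bullet> b)))"
proof -
  have "(2 * pi) powr (- real DIM('a) / 2) * exp (- (norm x)\<^sup>2 / 2) =
      (\<Prod>b\<in>Basis. std_normal_density (x \<bullet> b))" for x :: 'a
  proof -
    have "(norm x)\<^sup>2 = (\<Sum>b\<in>Basis. (x \<bullet> b)\<^sup>2)"
      by (simp add: norm_eq_sqrt_inner power2_eq_square euclidean_inner[of x x] sum_nonneg)
    then have "exp (- (norm x)\<^sup>2 / 2) = (\<Prod>b\<in>Basis. exp (- (x \<bullet> b)\<^sup>2 / 2))"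
      by (simp add: exp_sum[symmetric] sum_negf sum_divide_distrib)
    moreover have "(2 * pi) powr (- real DIM('a) / 2) = (1 / sqrt (2 * pi)) ^ DIM('a)"
    proof -
      have "1 / sqrt (2 * pi) = (2 * pi) powr (- 1 / 2)"
        by (simp add: powr_minus_divide powr_half_sqrt)
      then show ?thesis
        by (simp add: powr_power)
    qed
    ultimately show ?thesis
      by (simp add: std_normal_density_def prod.distrib prod_dividef power_divide)
  qed
  then show ?thesis
    by (simp add: std_gaussian_def prod_ennreal)
qed

lemma sets_std_gaussian [simp, measurable_cong]: "sets std_gaussian = sets borel"
  and space_std_gaussian [simp]: "space std_gaussian = UNIV"
  by (simp_all add: std_gaussian_def)

lemma prob_space_std_gaussian: "prob_space (std_gaussian :: 'a::euclidean_space measure)"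
proof
  have "(\<integral>\<^sup>+ x. ennreal (std_normal_density x) \<partial>lborel) = 1"
    using prob_space.emeasure_space_1[OF prob_space_normal_density[of 1 0]]
    by (simp add: emeasure_density)
  then have "(\<integral>\<^sup>+ x. (\<Prod>b\<in>Basis. ennreal (std_normal_density (x \<bullet> b))) \<partial>(lborel :: 'a measure)) = 1"
    by (subst nn_integral_lborel_prod) simp_all
  then show "emeasure (std_gaussian :: 'a measure) (space std_gaussian) = 1"
    by (simp add: std_gaussian_alt emeasure_density)
qed

text \<open>Dimensions and squared norms both add under pairing. Two independent copies thus form a
  single Gaussian on the product, to which orthogonal invariance applies.\<close>

lemma std_gaussian_pair:
  "(std_gaussian :: ('a::euclidean_space \<times> 'b::euclidean_space) measure) = std_gaussian \<Otimes>\<^sub>M std_gaussian"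
proof -
  interpret prob_space "std_gaussian :: 'b measure"
    by (rule prob_space_std_gaussian)
  have eq: "ennreal ((2 * pi) powr (- real DIM('a) / 2) * exp (- (norm x)\<^sup>2 / 2)) *
      ennreal ((2 * pi) powr (- real DIM('b) / 2) * exp (- (norm y)\<^sup>2 / 2)) =
      ennreal ((2 * pi) powr (- real DIM('a \<times> 'b) / 2) * exp (- (norm (x, y))\<^sup>2 / 2))"
    for x :: 'a and y :: 'b
  proof -
    have "(2 * pi) powr (- real DIM('a) / 2) * (2 * pi) powr (- real DIM('b) / 2) =
        (2 * pi) powr (- real DIM('a \<times> 'b) / 2)"
      by (simp add: powr_add[symmetric] add_divide_distrib diff_divide_distrib)
    moreover have "exp (- (norm x)\<^sup>2 / 2) * exp (- (norm y)\<^sup>2 / 2) = exp (- (norm (x, y))\<^sup>2 / 2)"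
      by (simp add: norm_Pair exp_add[symmetric] add_divide_distrib diff_divide_distrib)
    ultimately show ?thesis
      by (simp add: ennreal_mult'[symmetric] mult_ac)
  qed
  have eq': "(\<lambda>(x::'a, y::'b). ennreal ((2 * pi) powr (- real DIM('a) / 2) * exp (- (norm x)\<^sup>2 / 2)) *
      ennreal ((2 * pi) powr (- real DIM('b) / 2) * exp (- (norm y)\<^sup>2 / 2))) =
      (\<lambda>z. ennreal ((2 * pi) powr (- real DIM('a \<times> 'b) / 2) * exp (- (norm z)\<^sup>2 / 2)))"
    using eq by auto
  show ?thesis
    unfolding std_gaussian_def
    by (subst pair_measure_density)
      (use sigma_finite_measure_axioms in \<open>simp_all only: eq' lborel_prod sigma_finite_lborel\<close>,
       simp_all add: std_gaussian_def)
qed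

text \<open>Uniqueness of Haar measure, specialised: for the unit ball \<open>B\<close> the double integral of
  \<open>1\<^sub>B(y) 1\<^sub>A(x + f y)\<close> equals \<open>vol(B) vol(A)\<close> in one order and \<open>vol(B) vol(f\<inverse> A)\<close> in the other.\<close>
lemma distr_lborel_orthogonal:
  fixes f :: "'a::euclidean_space \<Rightarrow> 'a"
  assumes f: "orthogonal_transformation f"
  shows "distr lborel borel f = lborel"
proof (rule measure_eqI)
  fix A assume "A \<in> sets (distr lborel borel f)"
  then have A [measurable]: "A \<in> sets borel" by simp
  have lin: "linear f"
    using f by (rule orthogonal_transformation_linear)
  have [measurable]: "f \<in> borel_measurable borel"
    by (intro borel_measurable_continuous_onI linear_continuous_on)
      (simp add: linear_conv_bounded_linear[symmetric] lin)
  have [measurable]: "inv f \<in> borel_measurable borel"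
    by (intro borel_measurable_continuous_onI linear_continuous_on)
      (simp add: linear_conv_bounded_linear[symmetric] orthogonal_transformation_inv
        orthogonal_transformation_linear f)
  have finv: "f (inv f x) = x" for x
    using f by (simp add: orthogonal_transformation_surj surj_f_inv_f)
  define h :: "'a \<Rightarrow> ennreal" where "h = indicator (ball 0 1)"
  have h [measurable]: "h \<in> borel_measurable borel"
    unfolding h_def by (intro borel_measurable_indicator) simp
  define V where "V = (\<integral>\<^sup>+ y. h y \<partial>lborel)"
  have translate: "(\<integral>\<^sup>+ x. g (c + x) \<partial>lborel) = (\<integral>\<^sup>+ x. g x \<partial>lborel)"
    if "g \<in> borel_measurable borel" for g and c :: 'a
    using that by (subst (2) lborel_distr_plus[symmetric, of c]) (simp add: nn_integral_distr)
  \<comment> \<open>\<open>f\<close> preserves norms and the ball is symmetric about 0. This turns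
    the integrand into a translate in \<open>x\<close>, so that integrating over \<open>x\<close>
    gives \<open>V\<close>.\<close>
  have h_refl: "h (y - inv f x) = h (- f y + x)" for x y
  proof -
    have "f (y - inv f x) = f y - x"
      by (simp add: linear_diff[OF lin] finv)
    then have "norm (y - inv f x) = norm (f y - x)"
      by (metis f orthogonal_transformation_norm)
    then show ?thesis
      by (simp add: h_def indicator_def norm_minus_commute)
  qed
  have "emeasure lborel A * V = (\<integral>\<^sup>+ y. (\<integral>\<^sup>+ x. h y * indicator A (f y + x) \<partial>lborel) \<partial>lborel)"
    by (simp add: V_def nn_integral_cmult nn_integral_multc translate mult.commute)
  also have "\<dots> = (\<integral>\<^sup>+ x. (\<integral>\<^sup>+ y. h y * indicator A (f y + x) \<partial>lborel) \<partial>lborel)"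
    by (rule lborel_pair.Fubini') simp
  also have "\<dots> = (\<integral>\<^sup>+ x. (\<integral>\<^sup>+ y. h (y - inv f x) * indicator A (f y) \<partial>lborel) \<partial>lborel)"
  proof (rule nn_integral_cong)
    fix x :: 'a
    have "(\<integral>\<^sup>+ y. h (y - inv f x) * indicator A (f y) \<partial>lborel) =
        (\<integral>\<^sup>+ y. h (inv f x + y - inv f x) * indicator A (f (inv f x + y)) \<partial>lborel)"
      by (rule translate[symmetric]) simp
    then show "(\<integral>\<^sup>+ y. h y * indicator A (f y + x) \<partial>lborel) =
        (\<integral>\<^sup>+ y. h (y - inv f x) * indicator A (f y) \<partial>lborel)"
      by (simp add: linear_add[OF lin] finv add.commute)
  qed
  also have "\<dots> = (\<integral>\<^sup>+ y. (\<integral>\<^sup>+ x. h (y - inv f x) * indicator A (f y) \<partial>lborel) \<partial>lborel)"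
    by (rule lborel_pair.Fubini') simp
  also have "\<dots> = (\<integral>\<^sup>+ y. V * indicator A (f y) \<partial>lborel)"
    using translate[of h "- f y" for y] by (simp add: h_refl nn_integral_multc V_def)
  also have "\<dots> = emeasure (distr lborel borel f) A * V"
    by (subst nn_integral_indicator[symmetric], simp, subst nn_integral_distr)
      (simp_all add: nn_integral_cmult mult.commute)
  finally have *: "emeasure lborel A * V = emeasure (distr lborel borel f) A * V" .
  have V: "V = emeasure lborel (ball (0::'a) 1)"
    by (simp add: V_def h_def)
  have "V \<noteq> 0"
    using open_not_negligible[of "ball (0::'a) 1"]
    by (auto simp: V negligible_iff_emeasure0)
  moreover have "V \<noteq> \<infinity>"
    using emeasure_bounded_finite[of "ball (0::'a) 1"] by (simp add: V)
  ultimately show "emeasure (distr lborel borel f) A = emeasure lborel A"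
    using * by (auto simp: mult.commute[of _ V] ennreal_mult_cancel_left)
qed simp

text \<open>Lebesgue measure is invariant under \<open>f\<close>, and the density depends on
  \<open>norm x\<close> only.\<close>

lemma distr_std_gaussian_orthogonal:
  fixes f :: "'a::euclidean_space \<Rightarrow> 'a"
  assumes "orthogonal_transformation f"
  shows "distr std_gaussian borel f = std_gaussian"
proof -
  have [measurable]: "f \<in> borel_measurable borel"
    using assms by (intro borel_measurable_continuous_onI linear_continuous_on)
      (simp add: linear_conv_bounded_linear[symmetric] orthogonal_transformation_linear)
  show ?thesis
    unfolding std_gaussian_def
    by (subst (2) distr_lborel_orthogonal[OF assms, symmetric], subst density_distr)
      (use assms in \<open>simp_all add: o_def orthogonal_transformation_norm\<close>)
qed

lemma integral_std_gaussian_orthogonal: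
  fixes f :: "'a::euclidean_space \<Rightarrow> 'a" and g :: "'a \<Rightarrow> real"
  assumes f: "orthogonal_transformation f" and "g \<in> borel_measurable borel"
  shows "(\<integral>x. g (f x) \<partial>std_gaussian) = (\<integral>x. g x \<partial>std_gaussian)"
proof -
  have [measurable]: "f \<in> borel_measurable borel"
    using assms by (intro borel_measurable_continuous_onI linear_continuous_on)
      (simp add: linear_conv_bounded_linear[symmetric] orthogonal_transformation_linear)
  show ?thesis
    using assms(2) by (subst (2) distr_std_gaussian_orthogonal[OF f, symmetric], subst integral_distr) auto
qed

definition swap_coord :: "'n \<Rightarrow> (real^'n) \<times> (real^'n) \<Rightarrow> (real^'n) \<times> (real^'n)" where
  "swap_coord i z =
     ((\<chi> k. if k = i then snd z $ k else fst z $ k), (\<chi> k. if k = i then fst z $ k else snd z $ k))"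

lemma linear_swap_coord: "linear (swap_coord i)"
  by (intro linearI) (auto simp: swap_coord_def vec_eq_iff prod_eq_iff)

text \<open>The map permutes the coordinates of the doubled space, so the Gaussian measure on pairs
  is invariant under it.\<close>

lemma orthogonal_transformation_swap_coord:
  fixes i :: "'n::finite"
  shows "orthogonal_transformation (swap_coord i)"
proof -
  have "swap_coord i z \<bullet> swap_coord i z = z \<bullet> z" for z :: "(real^'n) \<times> (real^'n)"
  proof -
    have "swap_coord i z \<bullet> swap_coord i z =
        (\<Sum>k\<in>UNIV. (fst (swap_coord i z) $ k)\<^sup>2 + (snd (swap_coord i z) $ k)\<^sup>2)"
      by (simp add: inner_prod_def inner_vec_def sum.distrib power2_eq_square)
    also have "\<dots> = (\<Sum>k\<in>UNIV. (fst z $ k)\<^sup>2 + (snd z $ k)\<^sup>2)"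
      by (intro sum.cong) (auto simp: swap_coord_def)
    also have "\<dots> = z \<bullet> z"
      by (simp add: inner_prod_def inner_vec_def sum.distrib power2_eq_square)
    finally show ?thesis .
  qed
  then show ?thesis
    by (simp add: orthogonal_transformation norm_eq_sqrt_inner linear_swap_coord)
qed

subsection \<open>The Harris inequality\<close>

lemma integrable_std_gaussian_bounded:
  fixes f :: "'a::euclidean_space \<Rightarrow> real"
  assumes "f \<in> borel_measurable borel" "\<And>x. \<bar>f x\<bar> \<le> B"
  shows "integrable std_gaussian f"
proof -
  interpret prob_space "std_gaussian :: 'a measure"
    by (rule prob_space_std_gaussian)
  show ?thesis
    using assms by (intro integrable_const_bound[of _ B]) (auto simp: measurable_cong_sets[OF sets_std_gaussian refl])
qed

definition mix_coords :: "'n set \<Rightarrow> real^'n \<Rightarrow> real^'n \<Rightarrow> real^'n" where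
  "mix_coords J x y = (\<chi> k. if k \<in> J then x $ k else y $ k)"

lemma borel_measurable_mix_coords [measurable]:
  "(\<lambda>z. mix_coords J (fst z) (snd z)) \<in> borel_measurable (borel :: ((real^'n) \<times> (real^'n)) measure)"
proof (rule borel_measurable_continuous_onI)
  have "continuous_on UNIV (\<lambda>z. if k \<in> J then fst z $ k else snd z $ k)"
    for k and J :: "'n set"
    by (cases "k \<in> J") (auto intro!: continuous_intros)
  then show "continuous_on UNIV (\<lambda>z. mix_coords J (fst z) (snd z))"
    unfolding mix_coords_def by (intro continuous_on_vec_lambda)
qed

text \<open>Starting from independent copies \<open>x\<close>, \<open>y\<close>, the second argument \<open>y\<close> is turned into \<open>x\<close> one
  coordinate at a time; symmetrising over the exchange of the \<open>i\<close>-th coordinates of \<open>x\<close> and \<open>y\<close>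
  reduces each step to Chebyshev's inequality in one variable.\<close>
lemma std_gaussian_harris:
  fixes f g :: "real^'n \<Rightarrow> real"
  assumes f [measurable]: "f \<in> borel_measurable borel" and g [measurable]: "g \<in> borel_measurable borel"
    and f_bd: "\<And>x. \<bar>f x\<bar> \<le> B" and g_bd: "\<And>x. \<bar>g x\<bar> \<le> C"
    and f_mono: "\<And>x y. (\<And>k. \<bar>x $ k\<bar> \<le> \<bar>y $ k\<bar>) \<Longrightarrow> f y \<le> f x"
    and g_mono: "\<And>x y. (\<And>k. \<bar>x $ k\<bar> \<le> \<bar>y $ k\<bar>) \<Longrightarrow> g y \<le> g x"
  shows "(\<integral>x. f x \<partial>std_gaussian) * (\<integral>x. g x \<partial>std_gaussian) \<le> (\<integral>x. f x * g x \<partial>std_gaussian)"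
proof -
  interpret G: prob_space "std_gaussian :: (real^'n) measure"
    by (rule prob_space_std_gaussian)
  interpret GG: pair_prob_space "std_gaussian :: (real^'n) measure" "std_gaussian :: (real^'n) measure" ..
  define F where "F J = (\<integral>z. f (fst z) * g (mix_coords J (fst z) (snd z)) \<partial>std_gaussian)" for J
  have [measurable]: "fst \<in> borel_measurable (borel :: ((real^'n) \<times> (real^'n)) measure)"
    by (intro borel_measurable_continuous_onI continuous_on_fst continuous_on_id)
  have int: "integrable std_gaussian (\<lambda>z. f (fst z) * g (mix_coords J (fst z) (snd z)))" for J
  proof (rule integrable_std_gaussian_bounded)
    show "\<bar>f (fst z) * g (mix_coords J (fst z) (snd z))\<bar> \<le> B * C" for z
      unfolding abs_mult by (intro mult_mono f_bd g_bd order_trans[OF abs_ge_zero f_bd]) auto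
  qed simp
  have step: "F J \<le> F (insert i J)" if "i \<notin> J" for i J
  proof -
    define d where "d z = g (mix_coords (insert i J) (fst z) (snd z)) - g (mix_coords J (fst z) (snd z))" for z
    define h where "h z = f (fst z) * d z" for z
    have [measurable]: "h \<in> borel_measurable borel" "swap_coord i \<in> borel_measurable borel"
      unfolding h_def d_def
      by (auto intro!: borel_measurable_continuous_onI linear_continuous_on
          simp: linear_conv_bounded_linear[symmetric] linear_swap_coord)
    have h_eq: "h = (\<lambda>z. f (fst z) * g (mix_coords (insert i J) (fst z) (snd z))
        - f (fst z) * g (mix_coords J (fst z) (snd z)))"
      by (auto simp: h_def d_def right_diff_distrib)
    have h_int: "integrable std_gaussian h"
      unfolding h_eq by (intro Bochner_Integration.integrable_diff int)
    have "integrable (distr std_gaussian borel (swap_coord i)) h"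
      by (simp add: h_int distr_std_gaussian_orthogonal orthogonal_transformation_swap_coord)
    then have h_int': "integrable std_gaussian (\<lambda>z. h (swap_coord i z))"
      by (simp add: integrable_distr_eq)
    \<comment> \<open>The two mixed points differ only in where the \<open>i\<close>-th coordinate
      is taken from, so the exchange turns each into the other.\<close>
    have "d (swap_coord i z) = - d z" for z
    proof -
      have "mix_coords (insert i J) (fst (swap_coord i z)) (snd (swap_coord i z)) = mix_coords J (fst z) (snd z)"
        "mix_coords J (fst (swap_coord i z)) (snd (swap_coord i z)) = mix_coords (insert i J) (fst z) (snd z)"
        using \<open>i \<notin> J\<close> by (auto simp: vec_eq_iff mix_coords_def swap_coord_def)
      then show ?thesis by (simp add: d_def)
    qed
    then have sum: "h z + h (swap_coord i z) = (f (fst z) - f (fst (swap_coord i z))) * d z" for z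
      by (simp add: h_def algebra_simps)
    \<comment> \<open>Both factors have the same sign: if \<open>\<bar>snd z $ i\<bar>\<close> is
      the larger one, the exchange can only lower \<open>f\<close>, and taking
      \<open>fst z $ i\<close> in its place can only raise \<open>g\<close>.\<close>
    have nonneg: "0 \<le> h z + h (swap_coord i z)" for z
    proof (cases "\<bar>fst z $ i\<bar> \<le> \<bar>snd z $ i\<bar>")
      case True
      then have "f (fst (swap_coord i z)) \<le> f (fst z)"
        by (intro f_mono) (simp add: swap_coord_def)
      moreover have "0 \<le> d z"
        using True \<open>i \<notin> J\<close> unfolding d_def by (simp, intro g_mono) (auto simp: mix_coords_def)
      ultimately show ?thesis by (simp add: sum)
    next
      case False
      then have "f (fst z) \<le> f (fst (swap_coord i z))"
        by (intro f_mono) (simp add: swap_coord_def)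
      moreover have "d z \<le> 0"
        using False \<open>i \<notin> J\<close> unfolding d_def by (simp, intro g_mono) (auto simp: mix_coords_def)
      ultimately show ?thesis by (simp add: sum mult_nonpos_nonpos)
    qed
    \<comment> \<open>The exchange preserves the measure, so this is twice the integral of
      \<open>h\<close>, that is \<open>2 * (F (insert i J) - F J)\<close>.\<close>
    have "0 \<le> (\<integral>z. h z + h (swap_coord i z) \<partial>std_gaussian)"
      by (intro Bochner_Integration.integral_nonneg nonneg)
    also have "\<dots> = (\<integral>z. h z \<partial>std_gaussian) + (\<integral>z. h (swap_coord i z) \<partial>std_gaussian)"
      using h_int h_int' by simp
    also have "(\<integral>z. h (swap_coord i z) \<partial>std_gaussian) = (\<integral>z. h z \<partial>std_gaussian)"
      by (rule integral_std_gaussian_orthogonal[OF orthogonal_transformation_swap_coord]) simp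
    also have "(\<integral>z. h z \<partial>std_gaussian) = F (insert i J) - F J"
      unfolding h_eq F_def by (intro Bochner_Integration.integral_diff int)
    finally show ?thesis by simp
  qed
  have le: "F {} \<le> F J" if "finite J" for J
    using that by induction (use step in \<open>auto intro: order_trans\<close>)
  have f_int: "integrable std_gaussian f" and g_int: "integrable std_gaussian g"
    by (auto intro: integrable_std_gaussian_bounded f_bd g_bd)
  \<comment> \<open>For the empty set \<open>f\<close> and \<open>g\<close> are evaluated at
    independent points, for \<open>UNIV\<close> at the same point.\<close>
  have "F {} = (\<integral>z. f (fst z) * g (snd z) \<partial>(std_gaussian \<Otimes>\<^sub>M std_gaussian))"
    by (simp add: F_def mix_coords_def std_gaussian_pair)
  also have "\<dots> = (\<integral>x. \<integral>y. f x * g y \<partial>std_gaussian \<partial>std_gaussian)"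
    using int[of "{}"] by (subst GG.integral_fst'[symmetric]) (simp_all add: mix_coords_def std_gaussian_pair)
  also have "\<dots> = (\<integral>x. f x \<partial>std_gaussian) * (\<integral>x. g x \<partial>std_gaussian)"
    by simp
  finally have 1: "F {} = (\<integral>x. f x \<partial>std_gaussian) * (\<integral>x. g x \<partial>std_gaussian)" .
  have "F UNIV = (\<integral>z. f (fst z) * g (fst z) \<partial>(std_gaussian \<Otimes>\<^sub>M (std_gaussian :: (real^'n) measure)))"
    by (simp add: F_def mix_coords_def std_gaussian_pair)
  also have "\<dots> = (\<integral>x. \<integral>y. f x * g x \<partial>(std_gaussian :: (real^'n) measure) \<partial>std_gaussian)"
    using int[of UNIV] by (subst GG.integral_fst'[symmetric]) (simp_all add: mix_coords_def std_gaussian_pair)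
  also have "\<dots> = (\<integral>x. f x * g x \<partial>std_gaussian)"
    using G.prob_space by simp
  finally have 2: "F UNIV = (\<integral>x. f x * g x \<partial>std_gaussian)" .
  show ?thesis
    using le[of UNIV] 1 2 by simp
qed

subsection \<open>Plane rotations and orthogonal columns\<close>

definition givens :: "'n \<Rightarrow> 'n \<Rightarrow> real \<Rightarrow> real^'n \<Rightarrow> real^'n" where
  "givens i j t x = (\<chi> k. if k = i then cos t * x $ i - sin t * x $ j
     else if k = j then sin t * x $ i + cos t * x $ j else x $ k)"

lemma linear_givens: "linear (givens i j t)"
  by (intro linearI) (auto simp: givens_def vec_eq_iff algebra_simps)

lemma sum_two_coords:
  fixes f :: "'n::finite \<Rightarrow> 'a::comm_monoid_add"
  assumes "i \<noteq> j"
  shows "(\<Sum>k\<in>UNIV. f k) = f i + f j + (\<Sum>k\<in>UNIV - {i, j}. f k)"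
proof -
  have "(\<Sum>k\<in>UNIV. f k) = (\<Sum>k\<in>UNIV - {i, j}. f k) + (\<Sum>k\<in>{i, j}. f k)"
    by (rule sum.subset_diff) auto
  with assms show ?thesis by (simp add: add.commute)
qed

lemma orthogonal_transformation_givens:
  assumes "i \<noteq> j"
  shows "orthogonal_transformation (givens i j t)"
proof -
  have "givens i j t x \<bullet> givens i j t x = x \<bullet> x" for x
  proof -
    have "(cos t * x $ i - sin t * x $ j)\<^sup>2 + (sin t * x $ i + cos t * x $ j)\<^sup>2 =
        ((sin t)\<^sup>2 + (cos t)\<^sup>2) * ((x $ i)\<^sup>2 + (x $ j)\<^sup>2)"
      by algebra
    then have "(cos t * x $ i - sin t * x $ j)\<^sup>2 + (sin t * x $ i + cos t * x $ j)\<^sup>2 =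
        (x $ i)\<^sup>2 + (x $ j)\<^sup>2"
      by simp
    moreover have "(\<Sum>k\<in>UNIV - {i, j}. (givens i j t x $ k)\<^sup>2) = (\<Sum>k\<in>UNIV - {i, j}. (x $ k)\<^sup>2)"
      by (intro sum.cong) (auto simp: givens_def)
    ultimately show ?thesis
      using assms by (simp add: inner_vec_def power2_eq_square[symmetric] sum_two_coords[OF assms] givens_def)
  qed
  then show ?thesis
    by (simp add: orthogonal_transformation norm_eq_sqrt_inner linear_givens)
qed

definition givens_matrix :: "'n \<Rightarrow> 'n \<Rightarrow> real \<Rightarrow> real^'n^'n" where
  "givens_matrix i j t = matrix (givens i j t)"

lemma givens_matrix_mult: "givens_matrix i j t *v x = givens i j t x"
  by (simp add: givens_matrix_def matrix_works linear_givens)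

lemma orthogonal_matrix_givens_matrix: "i \<noteq> j \<Longrightarrow> orthogonal_matrix (givens_matrix i j t)"
  using orthogonal_transformation_givens[of i j t]
  by (simp add: givens_matrix_def orthogonal_transformation_matrix)

text \<open>Column \<open>k\<close> is \<open>V\<close> applied to the rotated \<open>k\<close>-th
  basis vector, and the rotation moves only \<open>axis i 1\<close> and
  \<open>axis j 1\<close>.\<close>

lemma column_mult_givens_matrix:
  fixes V :: "real^'n^'n"
  assumes "i \<noteq> j"
  shows "column k (V ** givens_matrix i j t) =
    (if k = i then cos t *\<^sub>R column i V + sin t *\<^sub>R column j V
     else if k = j then - sin t *\<^sub>R column i V + cos t *\<^sub>R column j V else column k V)"
proof -
  have "column k (V ** givens_matrix i j t) = V *v givens i j t (axis k 1)"
    by (simp add: matrix_vector_mult_basis[symmetric] matrix_vector_mul_assoc[symmetric] givens_matrix_mult)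
  moreover have "givens i j t (axis k 1) =
    (if k = i then cos t *\<^sub>R axis i 1 + sin t *\<^sub>R axis j 1
     else if k = j then - sin t *\<^sub>R axis i 1 + cos t *\<^sub>R axis j 1 else axis k 1)"
    using assms by (auto simp: givens_def vec_eq_iff axis_def)
  ultimately show ?thesis
    by (simp add: matrix_vector_right_distrib matrix_vector_mult_diff_distrib vector_scaleR_matrix_ac matrix_vector_mult_basis
       matrix_vector_mult_scaleR)
qed

text \<open>Cut out by polynomial equations, and bounded since the rows are unit vectors.\<close>

lemma compact_orthogonal_matrices: "compact {U :: real^'n^'n. orthogonal_matrix U}"
proof -
  have "closed {U :: real^'n^'n. transpose U ** U = mat 1}"
    unfolding matrix_matrix_mult_def transpose_def
    by (intro closed_Collect_eq continuous_on_vec_lambda continuous_intros)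
  moreover have "bounded {U :: real^'n^'n. orthogonal_matrix U}"
  proof (rule boundedI)
    fix U :: "real^'n^'n" assume "U \<in> {U. orthogonal_matrix U}"
    then have "norm (U $ i) = 1" for i
      by (simp add: orthogonal_matrix_orthonormal_rows row_def vec_lambda_eta)
    then show "norm U \<le> real CARD('n)"
      using L2_set_le_sum[of UNIV "\<lambda>i. norm (U $ i)"] by (simp add: norm_vec_def)
  qed
  ultimately show ?thesis
    by (simp add: compact_eq_bounded_closed orthogonal_matrix)
qed

text \<open>Jacobi's method in variational form: with distinct weights \<open>w\<close>, a rotation in the
  coordinate plane \<open>(i, j)\<close> changes \<open>\<Sum>k. w k * (norm (column k (T ** U)))\<^sup>2\<close> to first order by
  \<open>2 (w i - w j)\<close> times the inner product of the columns.\<close>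
lemma exists_orthogonal_columns:
  fixes T :: "real^'n^'n" and K :: "(real^'n^'n) set"
  assumes "compact K" "K \<noteq> {}"
  obtains U where "U \<in> K"
    "\<And>i j. i \<noteq> j \<Longrightarrow> (\<And>t. U ** givens_matrix i j t \<in> K) \<Longrightarrow>
      column i (T ** U) \<bullet> column j (T ** U) = 0"
proof -
  obtain w :: "'n \<Rightarrow> nat" where w: "inj w"
    using finite_imp_inj_to_nat_seg[of "UNIV :: 'n set"] by auto
  define J :: "real^'n^'n \<Rightarrow> real" where "J V = (\<Sum>k\<in>UNIV. real (w k) * (norm (column k V))\<^sup>2)" for V
  have "continuous_on K (\<lambda>U. J (T ** U))"
    unfolding J_def column_def matrix_matrix_mult_def
    by (intro continuous_intros continuous_on_vec_lambda)
  \<comment> \<open>The maximum is taken over \<open>K\<close> only, so the first-order condition is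
    available exactly for planes whose rotations keep \<open>U\<close> inside \<open>K\<close>. This
    permits a choice within a set of minimisers.\<close>
  then obtain U where U: "U \<in> K" "\<And>W. W \<in> K \<Longrightarrow> J (T ** W) \<le> J (T ** U)"
    using continuous_attains_sup[of K "\<lambda>U. J (T ** U)"] assms by auto
  show thesis
  proof (rule that[OF U(1)])
    fix i j assume ij: "i \<noteq> j" and K: "\<And>t. U ** givens_matrix i j t \<in> K"
    define a where "a = column i (T ** U)"
    define b where "b = column j (T ** U)"
    define R where "R = (\<Sum>k\<in>UNIV - {i, j}. real (w k) * (norm (column k (T ** U)))\<^sup>2)"
    define \<phi> where "\<phi> t = w i * ((cos t *\<^sub>R a + sin t *\<^sub>R b) \<bullet> (cos t *\<^sub>R a + sin t *\<^sub>R b))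
      + w j * ((cos t *\<^sub>R b - sin t *\<^sub>R a) \<bullet> (cos t *\<^sub>R b - sin t *\<^sub>R a)) + R" for t
    have \<phi>: "J (T ** (U ** givens_matrix i j t)) = \<phi> t" for t
    proof -
      have "(\<Sum>k\<in>UNIV - {i, j}. real (w k) * (norm (column k ((T ** U) ** givens_matrix i j t)))\<^sup>2) = R"
        unfolding R_def by (intro sum.cong) (auto simp: column_mult_givens_matrix[OF ij])
      then show ?thesis
        using ij
        by (simp add: J_def \<phi>_def sum_two_coords[OF ij] matrix_mul_assoc column_mult_givens_matrix[OF ij]
            power2_norm_eq_inner a_def b_def)
    qed
    have "\<phi> 0 = J (T ** U)"
      using ij by (simp add: J_def \<phi>_def sum_two_coords[OF ij] power2_norm_eq_inner a_def b_def R_def)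
    then have max: "\<phi> t \<le> \<phi> 0" for t
      using U(2)[OF K[of t]] \<phi>[of t] by simp
    have "(\<phi> has_real_derivative 2 * (real (w i) - real (w j)) * (a \<bullet> b)) (at 0)"
      unfolding \<phi>_def inner_add_left inner_add_right inner_diff_left inner_diff_right inner_scaleR_left inner_scaleR_right
      by (auto intro!: derivative_eq_intros simp: algebra_simps inner_commute)
    then have "2 * (real (w i) - real (w j)) * (a \<bullet> b) = 0"
      by (rule DERIV_local_max[of _ _ _ 1]) (use max in auto)
    moreover have "w i \<noteq> w j"
      using ij w by (auto dest: injD)
    ultimately show "column i (T ** U) \<bullet> column j (T ** U) = 0"
      by (simp add: a_def b_def)
  qed
qed

lemma norm_matrix_vector_mult_expand:
  fixes T :: "real^'n^'n"
  shows "(norm (T *v x))\<^sup>2 = (\<Sum>i\<in>UNIV. \<Sum>j\<in>UNIV. x $ i * x $ j * (column i T \<bullet> column j T))"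
  by (simp add: power2_norm_eq_inner matrix_mult_sum inner_sum_left inner_sum_right
      scalar_mult_eq_scaleR sum_distrib_left mult_ac inner_commute)

lemma norm_matrix_vector_mult_orthogonal_columns:
  fixes T :: "real^'n^'n"
  assumes "\<And>i j. i \<noteq> j \<Longrightarrow> column i T \<bullet> column j T = 0"
  shows "(norm (T *v x))\<^sup>2 = (\<Sum>k\<in>UNIV. (norm (column k T))\<^sup>2 * (x $ k)\<^sup>2)"
proof -
  have "(\<Sum>j\<in>UNIV. x $ i * x $ j * (column i T \<bullet> column j T)) = (norm (column i T))\<^sup>2 * (x $ i)\<^sup>2" for i
  proof -
    have "(\<Sum>j\<in>UNIV. x $ i * x $ j * (column i T \<bullet> column j T)) =
        (\<Sum>j\<in>UNIV. if j = i then x $ i * x $ i * (column i T \<bullet> column i T) else 0)"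
      by (intro sum.cong) (auto simp: assms)
    then show ?thesis
      by (simp add: power2_norm_eq_inner flip: power2_eq_square)
  qed
  then show ?thesis
    by (simp add: norm_matrix_vector_mult_expand)
qed

subsection \<open>Integrals depending on a parameter\<close>

lemma borel_measurable_std_gaussian_iff:
  "f \<in> borel_measurable std_gaussian \<longleftrightarrow> f \<in> borel_measurable borel"
  by (simp add: measurable_cong_sets[OF sets_std_gaussian refl])

text \<open>Dominated convergence along sequences; the constant \<open>B\<close> is integrable
  because the total mass is 1.\<close>

lemma continuous_on_integral_std_gaussian:
  fixes h :: "'b::metric_space \<Rightarrow> 'a::euclidean_space \<Rightarrow> real"
  assumes cont: "\<And>x. continuous_on S (\<lambda>u. h u x)"
    and meas: "\<And>u. h u \<in> borel_measurable borel"
    and bd: "\<And>u x. \<bar>h u x\<bar> \<le> B"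
  shows "continuous_on S (\<lambda>u. \<integral>x. h u x \<partial>std_gaussian)"
proof -
  interpret prob_space "std_gaussian :: 'a measure"
    by (rule prob_space_std_gaussian)
  show ?thesis
  proof (rule continuous_on_sequentiallyI)
    fix X u assume X: "\<forall>n. X n \<in> S" "u \<in> S" "X \<longlonglongrightarrow> u"
    show "(\<lambda>n. \<integral>x. h (X n) x \<partial>std_gaussian) \<longlonglongrightarrow> (\<integral>x. h u x \<partial>std_gaussian)"
    proof (rule integral_dominated_convergence[where w = "\<lambda>_. B"])
      show "AE x in std_gaussian. (\<lambda>n. h (X n) x) \<longlonglongrightarrow> h u x"
        using X cont by (intro always_eventually allI continuous_on_tendsto_compose[of S "\<lambda>u. h u _"]) auto
    qed (use meas bd in \<open>auto simp: borel_measurable_std_gaussian_iff\<close>)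
  qed
qed

text \<open>By the mean value theorem the difference quotients are bounded by \<open>B\<close>, so
  dominated convergence applies along every sequence tending to 0.\<close>

lemma DERIV_integral_std_gaussian:
  fixes h :: "real \<Rightarrow> 'a::euclidean_space \<Rightarrow> real"
  assumes deriv: "\<And>t x. ((\<lambda>t. h t x) has_real_derivative h' t x) (at t)"
    and int: "\<And>t. integrable std_gaussian (h t)"
    and meas: "h' 0 \<in> borel_measurable borel"
    and bd: "\<And>t x. \<bar>h' t x\<bar> \<le> B"
  shows "((\<lambda>t. \<integral>x. h t x \<partial>std_gaussian) has_real_derivative (\<integral>x. h' 0 x \<partial>std_gaussian)) (at 0)"
proof -
  interpret prob_space "std_gaussian :: 'a measure"
    by (rule prob_space_std_gaussian)
  show ?thesis
    unfolding has_field_derivative_iff tendsto_at_iff_sequentially comp_def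
  proof (intro allI impI)
    fix X :: "nat \<Rightarrow> real" assume X: "\<forall>n. X n \<in> UNIV - {0}" "X \<longlonglongrightarrow> 0"
    then have X0: "X n \<noteq> 0" for n by auto
    have "(\<lambda>n. \<integral>x. (h (X n) x - h 0 x) / X n \<partial>std_gaussian) \<longlonglongrightarrow> (\<integral>x. h' 0 x \<partial>std_gaussian)"
    proof (rule integral_dominated_convergence[where w = "\<lambda>_. B"])
      show "AE x in std_gaussian. (\<lambda>n. (h (X n) x - h 0 x) / X n) \<longlonglongrightarrow> h' 0 x"
        using deriv[of _ 0] X unfolding has_field_derivative_iff tendsto_at_iff_sequentially comp_def by auto
      show "AE x in std_gaussian. norm ((h (X n) x - h 0 x) / X n) \<le> B" for n
      proof (intro always_eventually allI)
        fix x
        have "norm (h (X n) x - h 0 x) \<le> B * norm (X n - 0)"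
          by (rule field_differentiable_bound[of UNIV "\<lambda>t. h t x" "\<lambda>t. h' t x"])
            (use deriv bd in auto)
        then show "norm ((h (X n) x - h 0 x) / X n) \<le> B"
          using X0[of n] by (simp add: norm_divide divide_le_eq)
      qed
      show "(\<lambda>x. (h (X n) x - h 0 x) / X n) \<in> borel_measurable std_gaussian" for n
        using int by (intro borel_measurable_divide borel_measurable_diff borel_measurable_const) auto
    qed (use meas in \<open>auto simp: borel_measurable_std_gaussian_iff\<close>)
    also have "(\<lambda>n. \<integral>x. (h (X n) x - h 0 x) / X n \<partial>std_gaussian) =
        (\<lambda>n. ((\<integral>x. h (X n) x \<partial>std_gaussian) - (\<integral>x. h 0 x \<partial>std_gaussian)) / (X n - 0))"
      using int by (simp add: Bochner_Integration.integral_diff)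
    finally show "(\<lambda>n. ((\<integral>x. h (X n) x \<partial>std_gaussian) - (\<integral>x. h 0 x \<partial>std_gaussian)) / (X n - 0))
        \<longlonglongrightarrow> (\<integral>x. h' 0 x \<partial>std_gaussian)" .
  qed
qed

text \<open>The Gaussian density is positive everywhere, so the open set where \<open>h\<close> is
  nonzero is Lebesgue null, and a null open set is empty.\<close>

lemma integral_std_gaussian_eq_0_imp:
  fixes h :: "'a::euclidean_space \<Rightarrow> real"
  assumes cont: "continuous_on UNIV h" and nonneg: "\<And>x. 0 \<le> h x"
    and int: "integrable std_gaussian h" and zero: "(\<integral>x. h x \<partial>std_gaussian) = 0"
  shows "h x = 0"
proof -
  have "AE x in std_gaussian. h x = 0"
    using integral_nonneg_eq_0_iff_AE[OF int] nonneg zero by simp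
  then have "AE x in lborel. h x = 0"
    unfolding std_gaussian_def by (subst (asm) AE_density) auto
  then have "AE x in lborel. x \<notin> {x. h x \<noteq> 0}" by simp
  moreover have op: "open {x. h x \<noteq> 0}"
    using cont by (intro open_Collect_neq) auto
  ultimately have "{x. h x \<noteq> 0} \<in> null_sets lborel"
    by (subst (asm) AE_iff_null_sets[symmetric]) auto
  then have "negligible {x. h x \<noteq> 0}"
    by (simp add: negligible_iff_null_sets null_sets_completionI)
  then show ?thesis
    using open_not_negligible[OF op] by auto
qed

text \<open>The division by \<open>k\<close> makes the limit \<open>1\<close> rather than \<open>exp (-1)\<close> at the boundary point
  \<open>s = 1\<close>, so that no null set has to be discarded in the limit.\<close>
definition soft_ind :: "nat \<Rightarrow> real \<Rightarrow> real" where
  "soft_ind k s = exp (- (s ^ k) / real k)"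

lemma soft_ind_nonneg [simp]: "0 \<le> soft_ind k s"
  and abs_soft_ind [simp]: "\<bar>soft_ind k s\<bar> = soft_ind k s"
  by (simp_all add: soft_ind_def)

lemma soft_ind_le_1 [simp]: "0 \<le> s \<Longrightarrow> soft_ind k s \<le> 1"
  by (simp add: soft_ind_def)

lemma soft_ind_strict_antimono: "0 < k \<Longrightarrow> 0 \<le> s \<Longrightarrow> s < t \<Longrightarrow> soft_ind k t < soft_ind k s"
  by (simp add: soft_ind_def divide_strict_right_mono power_strict_mono)

lemma soft_ind_antimono: "0 \<le> s \<Longrightarrow> s \<le> t \<Longrightarrow> soft_ind k t \<le> soft_ind k s"
  by (simp add: soft_ind_def divide_right_mono power_mono)

lemma continuous_on_soft_ind [continuous_intros]:
  "continuous_on S f \<Longrightarrow> continuous_on S (\<lambda>x. soft_ind k (f x))"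
  \<comment> \<open>For \<open>k = 0\<close> division by zero makes the exponent 0, so
    \<open>soft_ind 0\<close> is constant.\<close>
  unfolding soft_ind_def by (cases "k = 0") (auto intro!: continuous_intros)

lemma DERIV_soft_ind:
  "0 < k \<Longrightarrow> (soft_ind k has_real_derivative - (s ^ (k - 1)) * soft_ind k s) (at s)"
  unfolding soft_ind_def by (auto intro!: derivative_eq_intros)

text \<open>From \<open>y \<le> exp y\<close> at \<open>y = s ^ k / k\<close>. It gives the
  integrands of the rotational derivatives a bound independent of the point.\<close>

lemma power_times_soft_ind_le:
  assumes "0 < k" "0 \<le> s"
  shows "s ^ k * soft_ind k s \<le> k"
proof -
  have "s ^ k / k \<le> exp (s ^ k / k)"
    using exp_ge_add_one_self[of "s ^ k / k"] by linarith
  with assms have "s ^ k \<le> k * exp (s ^ k / k)"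
    by (simp add: field_simps)
  with assms show ?thesis
    by (simp add: soft_ind_def exp_minus field_simps)
qed

text \<open>Up to \<open>s = 1\<close> the exponent is at most \<open>1 / (k + 1)\<close> in
  absolute value; beyond 1 the growth of the power beats the denominator.\<close>

lemma soft_ind_tendsto:
  assumes "0 \<le> s"
  shows "(\<lambda>k. soft_ind (Suc k) s) \<longlonglongrightarrow> (if s \<le> 1 then 1 else 0)"
proof (cases "s \<le> 1")
  case True
  have "(\<lambda>k. - (s ^ Suc k) / real (Suc k)) \<longlonglongrightarrow> 0"
  proof (rule Lim_null_comparison)
    have "s ^ Suc k \<le> 1" for k
      using True assms by (intro power_le_one)
    then show "\<forall>\<^sub>F k in sequentially. norm (- (s ^ Suc k) / real (Suc k)) \<le> inverse (real (Suc k))"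
      using assms by (intro always_eventually allI) (simp add: divide_right_mono inverse_eq_divide del: of_nat_Suc power_Suc)
  qed (rule LIMSEQ_inverse_real_of_nat)
  then have "(\<lambda>k. exp (- (s ^ Suc k) / real (Suc k))) \<longlonglongrightarrow> exp 0"
    by (rule tendsto_exp)
  with True show ?thesis by (simp add: soft_ind_def)
next
  case False
  then have "filterlim (\<lambda>k. s ^ k / real k) at_top sequentially"
    by real_asymp
  then have "filterlim (\<lambda>k. s ^ Suc k / real (Suc k)) at_top sequentially"
    by (rule filterlim_compose) (rule filterlim_Suc)
  then have "(\<lambda>k. exp (- (s ^ Suc k / real (Suc k)))) \<longlonglongrightarrow> 0"
    by (intro filterlim_compose[OF exp_at_bot] filterlim_compose[OF filterlim_uminus_at_bot_at_top])
  with False show ?thesis by (simp add: soft_ind_def)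
qed

subsection \<open>Correlation for smoothed ellipsoids\<close>

definition reflect_coord :: "'n \<Rightarrow> real^'n \<Rightarrow> real^'n" where
  "reflect_coord i x = (\<chi> k. if k = i then - x $ k else x $ k)"

lemma orthogonal_transformation_reflect_coord: "orthogonal_transformation (reflect_coord i)"
proof -
  have "linear (reflect_coord i)"
    by (intro linearI) (auto simp: reflect_coord_def vec_eq_iff)
  moreover have "reflect_coord i x \<bullet> reflect_coord i x = x \<bullet> x" for x
    unfolding inner_vec_def by (intro sum.cong) (auto simp: reflect_coord_def)
  ultimately show ?thesis
    by (simp add: orthogonal_transformation norm_eq_sqrt_inner)
qed

text \<open>The second form is given in its principal axes, so that plane rotations act on it
  explicitly and coordinate reflections preserve it.\<close>

lemma correlation_diagonal:
  fixes T :: "real^'n^'n" and a :: "'n \<Rightarrow> real"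
  assumes k: "0 < k" and a: "\<And>i. 0 < a i"
  defines "p \<equiv> \<lambda>x::real^'n. \<Sum>i\<in>UNIV. a i * (x $ i)\<^sup>2"
  shows "(\<integral>x. soft_ind k ((norm (T *v x))\<^sup>2) \<partial>std_gaussian) * (\<integral>x. soft_ind k (p x) \<partial>std_gaussian)
    \<le> (\<integral>x. soft_ind k ((norm (T *v x))\<^sup>2) * soft_ind k (p x) \<partial>std_gaussian)"
proof -
  have p_nonneg: "0 \<le> p x" for x
    unfolding p_def using a by (intro sum_nonneg) (simp add: less_imp_le)
  have p_cont [continuous_intros]: "continuous_on A (\<lambda>z. p (g z))" if "continuous_on A g" for A and g :: "real^'n \<Rightarrow> _"
    unfolding p_def using that by (intro continuous_intros)
  have [measurable]: "p \<in> borel_measurable borel"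
    by (intro borel_measurable_continuous_onI continuous_intros)
  have T_cont [continuous_intros]: "continuous_on A (\<lambda>x. V *v g x)"
    if "continuous_on A g" for V :: "real^'n^'n" and A and g :: "real^'n \<Rightarrow> _"
    by (rule linear_continuous_on_compose[OF that, of "(*v) V"]) (rule matrix_vector_mul_linear)
  have soft_bd: "\<bar>soft_ind k (s x) * soft_ind k (t y)\<bar> \<le> 1" if "\<And>x. 0 \<le> s x" "\<And>y. 0 \<le> t y" for s t :: "real^'n \<Rightarrow> real" and x y
    using that by (simp add: abs_mult mult_le_one)

  \<comment> \<open>Minimisation over the orthogonal group\<close>
  define f where "f U = (\<integral>x. soft_ind k ((norm ((T ** U) *v x))\<^sup>2) * soft_ind k (p x) \<partial>std_gaussian)" for U
  let ?O = "{U :: real^'n^'n. orthogonal_matrix U}"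
  have "continuous_on ?O f"
    unfolding f_def
  proof (rule continuous_on_integral_std_gaussian[where B = 1])
    show "continuous_on ?O (\<lambda>U. soft_ind k ((norm ((T ** U) *v x))\<^sup>2) * soft_ind k (p x))" for x
      unfolding matrix_vector_mult_def matrix_matrix_mult_def
      by (intro continuous_intros continuous_on_vec_lambda)
    show "\<bar>soft_ind k ((norm ((T ** U) *v x))\<^sup>2) * soft_ind k (p x)\<bar> \<le> 1" for U x
      by (rule soft_bd) (simp_all add: p_nonneg)
    show "(\<lambda>x. soft_ind k ((norm ((T ** U) *v x))\<^sup>2) * soft_ind k (p x)) \<in> borel_measurable borel" for U
      by (intro borel_measurable_continuous_onI continuous_intros)
  qed
  moreover have "mat 1 \<in> ?O"
    by (simp add: orthogonal_matrix_id)
  ultimately obtain U1 where U1: "U1 \<in> ?O" "\<And>U. U \<in> ?O \<Longrightarrow> f U1 \<le> f U"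
    using continuous_attains_inf[of ?O f] compact_orthogonal_matrices by blast
  \<comment> \<open>Where \<open>a i = a j\<close>, rotating in that plane leaves \<open>f\<close>
    unchanged, so stationarity says nothing about the columns \<open>i\<close> and \<open>j\<close>.
    A second choice inside the set of minimisers handles these pairs.\<close>
  define K where "K = {U \<in> ?O. f U = f U1}"
  have "closedin (top_of_set ?O) {U \<in> ?O. f U = f U1}"
    using \<open>continuous_on ?O f\<close> by (intro continuous_closedin_preimage_constant)
  then have "compact K"
    unfolding K_def using closedin_compact compact_orthogonal_matrices by blast
  moreover have "K \<noteq> {}"
    using U1 by (auto simp: K_def)
  ultimately obtain U where "U \<in> K" and
    U: "\<And>i j. i \<noteq> j \<Longrightarrow> (\<And>t. U ** givens_matrix i j t \<in> K) \<Longrightarrow> column i (T ** U) \<bullet> column j (T ** U) = 0"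
    by (rule exists_orthogonal_columns[of K T]) (rule that; blast)
  then have U_orth: "orthogonal_matrix U" and U_min: "orthogonal_matrix W \<Longrightarrow> f U \<le> f W" for W
    using U1 by (auto simp: K_def)

  \<comment> \<open>Stationarity under plane rotations\<close>
  define Q where "Q i j = column i (T ** U) \<bullet> column j (T ** U)" for i j
  define q where "q x = (norm ((T ** U) *v x))\<^sup>2" for x
  have q_nonneg: "0 \<le> q x" for x by (simp add: q_def)
  have q_cont [continuous_intros]: "continuous_on A (\<lambda>z. q (g z))" if "continuous_on A g" for A and g :: "real^'n \<Rightarrow> _"
    unfolding q_def using that by (intro continuous_intros)
  have [measurable]: "q \<in> borel_measurable borel"
    by (intro borel_measurable_continuous_onI continuous_intros)
  have [measurable]: "soft_ind k \<in> borel_measurable borel"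
    by (intro borel_measurable_continuous_onI continuous_intros)
  \<comment> \<open>This is the derivative of \<open>soft_ind k\<close>.\<close>
  define \<psi> where "\<psi> = (\<lambda>s. - (s ^ (k - 1)) * soft_ind k s)"
  have [continuous_intros]: "continuous_on A (\<lambda>z. \<psi> (g z))" if "continuous_on A g" for A and g :: "real^'n \<Rightarrow> _"
    unfolding \<psi>_def using that by (intro continuous_intros)
  have [measurable]: "\<psi> \<in> borel_measurable borel"
    unfolding \<psi>_def by (intro borel_measurable_continuous_onI continuous_intros)
  define \<alpha> where "\<alpha> = Min (range a)"
  have \<alpha>: "0 < \<alpha>" "\<alpha> \<le> a i" for i
    using a by (auto simp: \<alpha>_def)
  \<comment> \<open>\<open>\<alpha> * \<bar>x $ i * x $ j\<bar> \<le> p x\<close> by the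
    arithmetic-geometric mean inequality, and \<open>p x * \<bar>\<psi> (p x)\<bar>\<close> is the
    quantity bounded in \<open>power_times_soft_ind_le\<close>.\<close>
  have \<psi>_bd: "\<bar>x $ i * x $ j * \<psi> (p x)\<bar> \<le> k / \<alpha>" for x i j
  proof -
    have le: "\<alpha> * (x $ i)\<^sup>2 \<le> p x" for i
    proof -
      have "\<alpha> * (x $ i)\<^sup>2 \<le> a i * (x $ i)\<^sup>2"
        using \<alpha> by (intro mult_right_mono) auto
      also have "\<dots> \<le> p x"
        unfolding p_def using a by (intro member_le_sum) (auto simp: less_imp_le)
      finally show ?thesis .
    qed
    have "2 * \<bar>x $ i * x $ j\<bar> \<le> (x $ i)\<^sup>2 + (x $ j)\<^sup>2"
      using sum_squares_bound[of "\<bar>x $ i\<bar>" "\<bar>x $ j\<bar>"] by (simp add: abs_mult)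
    then have "\<alpha> * (2 * \<bar>x $ i * x $ j\<bar>) \<le> \<alpha> * ((x $ i)\<^sup>2 + (x $ j)\<^sup>2)"
      using \<alpha>(1) by (intro mult_left_mono) auto
    then have "\<alpha> * \<bar>x $ i * x $ j\<bar> \<le> p x"
      using le[of i] le[of j] by (simp add: algebra_simps)
    then have "(\<alpha> * \<bar>x $ i * x $ j\<bar>) * \<bar>\<psi> (p x)\<bar> \<le> p x * \<bar>\<psi> (p x)\<bar>"
      by (intro mult_right_mono) auto
    also have "\<dots> = p x ^ k * soft_ind k (p x)"
      using k p_nonneg[of x] by (cases k) (simp_all add: \<psi>_def abs_mult power_abs)
    also have "\<dots> \<le> k"
      using k p_nonneg by (rule power_times_soft_ind_le)
    finally show ?thesis
      using \<alpha>(1) by (simp add: abs_mult field_simps)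
  qed
  \<comment> \<open>Up to the factor \<open>2 * (a j - a i)\<close>, this is the derivative at angle
    0 of the mixed integral \<open>H\<close> below.\<close>
  define M where "M i j = (\<integral>x. soft_ind k (q x) * (x $ i * x $ j * \<psi> (p x)) \<partial>std_gaussian)" for i j
  have int: "integrable std_gaussian (\<lambda>x. soft_ind k (r x) * (x $ i * x $ j * \<psi> (p x)))"
    if [measurable]: "r \<in> borel_measurable borel" and "\<And>x. 0 \<le> r x" for r i j
  proof (rule integrable_std_gaussian_bounded)
    show "\<bar>soft_ind k (r x) * (x $ i * x $ j * \<psi> (p x))\<bar> \<le> 1 * (k / \<alpha>)" for x
      unfolding abs_mult[of "soft_ind k (r x)"]
      using that(2) by (intro mult_mono \<psi>_bd) (auto simp: \<alpha>(1) less_imp_le)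
  qed simp
  txt \<open>If \<open>a i \<noteq> a j\<close>, minimality of \<open>f U\<close> under rotations in the \<open>(i, j)\<close>-plane gives \<open>M i j = 0\<close>; if
    \<open>a i = a j\<close>, these rotations preserve \<open>p\<close>, hence the set of minimisers, and the choice of \<open>U\<close> gives
    \<open>Q i j = 0\<close>.\<close>
  have QM: "Q i j * M i j = 0" if ij: "i \<noteq> j" for i j
  proof -
    \<comment> \<open>By invariance of the measure the rotation moves from \<open>q\<close> to the
      diagonal form \<open>p\<close> with the angle reversed, so only \<open>p\<close> has to be
      differentiated.\<close>
    define H where "H t = (\<integral>x. soft_ind k (q x) * soft_ind k (p (givens i j t x)) \<partial>std_gaussian)" for t
    have fH: "f (U ** givens_matrix i j t) = H (- t)" for t
    proof -
      have g: "givens i j (- t) (givens i j t x) = x" for x :: "real^'n"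
      proof -
        have "cos t * (cos t * c - sin t * d) + sin t * (sin t * c + cos t * d) = c"
          "cos t * (sin t * c + cos t * d) - sin t * (cos t * c - sin t * d) = d" for c d :: real
        proof -
          have "(sin t)\<^sup>2 + (cos t)\<^sup>2 = 1" by simp
          then show "cos t * (cos t * c - sin t * d) + sin t * (sin t * c + cos t * d) = c"
            "cos t * (sin t * c + cos t * d) - sin t * (cos t * c - sin t * d) = d"
            by algebra+
        qed
        with ij show ?thesis by (auto simp: givens_def vec_eq_iff)
      qed
      have "f (U ** givens_matrix i j t) =
          (\<integral>x. soft_ind k (q (givens i j t x)) * soft_ind k (p (givens i j (- t) (givens i j t x))) \<partial>std_gaussian)"
        by (simp add: f_def q_def g matrix_mul_assoc givens_matrix_mult flip: matrix_vector_mul_assoc)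
      also have "\<dots> = H (- t)"
        unfolding H_def
        by (rule integral_std_gaussian_orthogonal[OF orthogonal_transformation_givens[OF ij],
              of "\<lambda>x. soft_ind k (q x) * soft_ind k (p (givens i j (- t) x))"])
          (intro borel_measurable_continuous_onI continuous_intros linear_continuous_on_compose[OF _ linear_givens])
      finally show ?thesis .
    qed
    have H0: "H 0 = f U"
    proof -
      have "givens i j 0 x = x" for x :: "real^'n"
        by (auto simp: givens_def vec_eq_iff)
      then show ?thesis by (simp add: H_def f_def q_def)
    qed
    have orth: "orthogonal_matrix (U ** givens_matrix i j t)" for t
      by (intro orthogonal_matrix_mul U_orth orthogonal_matrix_givens_matrix ij)
    have p_givens: "p (givens i j t x) = a i * (cos t * x $ i - sin t * x $ j)\<^sup>2 +
        a j * (sin t * x $ i + cos t * x $ j)\<^sup>2 + (\<Sum>l\<in>UNIV - {i, j}. a l * (x $ l)\<^sup>2)" for t x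
    proof -
      have "(\<Sum>l\<in>UNIV - {i, j}. a l * (givens i j t x $ l)\<^sup>2) = (\<Sum>l\<in>UNIV - {i, j}. a l * (x $ l)\<^sup>2)"
        by (intro sum.cong) (auto simp: givens_def)
      then show ?thesis
        unfolding p_def sum_two_coords[OF ij] using ij by (simp add: givens_def)
    qed
    show ?thesis
    proof (cases "a i = a j")
      case True
      have "p (givens i j t x) = p x" for t x
      proof -
        have "(cos t * x $ i - sin t * x $ j)\<^sup>2 + (sin t * x $ i + cos t * x $ j)\<^sup>2 =
            ((sin t)\<^sup>2 + (cos t)\<^sup>2) * ((x $ i)\<^sup>2 + (x $ j)\<^sup>2)"
          by algebra
        with True show ?thesis
          unfolding p_givens by (simp add: p_def sum_two_coords[OF ij] flip: distrib_left)
      qed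
      then have "H t = H 0" for t by (simp add: H_def)
      then have "U ** givens_matrix i j t \<in> K" for t
        using \<open>U \<in> K\<close> orth H0 fH by (simp add: K_def)
      then have "Q i j = 0"
        unfolding Q_def by (rule U[OF ij])
      then show ?thesis by simp
    next
      case False
      define h' where "h' t x = 2 * (a j - a i) * (soft_ind k (q x) *
        (givens i j t x $ i * givens i j t x $ j * \<psi> (p (givens i j t x))))" for t x
      have "(H has_real_derivative (\<integral>x. h' 0 x \<partial>std_gaussian)) (at 0)"
        unfolding H_def
      proof (rule DERIV_integral_std_gaussian)
        fix t and x :: "real^'n"
        \<comment> \<open>The coordinates of the rotated point satisfy \<open>y_i' = - y_j\<close>
          and \<open>y_j' = y_i\<close>.\<close>
        have "((\<lambda>t. p (givens i j t x)) has_real_derivative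
            2 * (a j - a i) * (givens i j t x $ i * givens i j t x $ j)) (at t)"
          unfolding p_givens using ij
          by (auto intro!: derivative_eq_intros simp: givens_def power2_eq_square algebra_simps)
        then have "((\<lambda>t. soft_ind k (p (givens i j t x))) has_real_derivative
            \<psi> (p (givens i j t x)) * (2 * (a j - a i) * (givens i j t x $ i * givens i j t x $ j))) (at t)"
          unfolding \<psi>_def by (rule DERIV_chain2[OF DERIV_soft_ind[OF k]])
        then show "((\<lambda>t. soft_ind k (q x) * soft_ind k (p (givens i j t x))) has_real_derivative h' t x) (at t)"
          unfolding h'_def by (auto intro!: derivative_eq_intros simp: mult_ac)
        show "\<bar>h' t x\<bar> \<le> \<bar>2 * (a j - a i)\<bar> * (1 * (k / \<alpha>))"
          unfolding h'_def abs_mult[of "2 * (a j - a i)"] abs_mult[of "soft_ind k (q x)"]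
          using q_nonneg[of x] by (intro mult_mono \<psi>_bd) (auto simp: \<alpha>(1) less_imp_le)
      next
        fix t
        show "integrable std_gaussian (\<lambda>x. soft_ind k (q x) * soft_ind k (p (givens i j t x)))"
        proof (rule integrable_std_gaussian_bounded)
          show "\<bar>soft_ind k (q x) * soft_ind k (p (givens i j t x))\<bar> \<le> 1" for x
            by (simp add: abs_mult mult_le_one q_nonneg p_nonneg)
        qed (intro borel_measurable_continuous_onI continuous_intros linear_continuous_on_compose[OF _ linear_givens])
      next
        show "h' 0 \<in> borel_measurable borel"
          unfolding h'_def
          by (intro borel_measurable_continuous_onI continuous_intros linear_continuous_on_compose[OF _ linear_givens])
      qed
      moreover have "(\<integral>x. h' 0 x \<partial>std_gaussian) = 2 * (a j - a i) * M i j"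
      proof -
        have "givens i j 0 x = x" for x :: "real^'n"
          by (auto simp: givens_def vec_eq_iff)
        then show ?thesis by (simp add: h'_def M_def)
      qed
      moreover have "H 0 \<le> H t" for t
        using U_min[OF orth[of "- t"]] fH[of "- t"] H0 by simp
      ultimately have "2 * (a j - a i) * M i j = 0"
        by (intro DERIV_local_min[of H _ 0 1]) auto
      with False show ?thesis by simp
    qed
  qed

  \<comment> \<open>Vanishing of the off-diagonal part\<close>
  define d where "d x = (\<Sum>i\<in>UNIV. (x $ i)\<^sup>2 * Q i i)" for x
  define Z where "Z x = (\<Sum>i\<in>UNIV. \<Sum>j\<in>UNIV - {i}. x $ i * x $ j * Q i j)" for x
  have q_eq: "q x = d x + Z x" for x
    unfolding q_def norm_matrix_vector_mult_expand d_def Z_def Q_def[symmetric] sum.distrib[symmetric]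
    by (intro sum.cong refl, subst sum.remove[of UNIV]) (auto simp: power2_eq_square)
  have d_nonneg: "0 \<le> d x" for x
    by (auto simp: d_def Q_def intro!: sum_nonneg)
  have d_cont: "continuous_on UNIV d" and Z_cont: "continuous_on UNIV Z"
    unfolding d_def Z_def by (intro continuous_intros)+
  have [measurable]: "d \<in> borel_measurable borel"
    by (intro borel_measurable_continuous_onI d_cont)
  have expand: "soft_ind k (r x) * (Z x * \<psi> (p x)) =
      (\<Sum>i\<in>UNIV. \<Sum>j\<in>UNIV - {i}. Q i j * (soft_ind k (r x) * (x $ i * x $ j * \<psi> (p x))))" for r x
    by (simp add: Z_def sum_distrib_left sum_distrib_right mult_ac)
  have intZ: "integrable std_gaussian (\<lambda>x. soft_ind k (r x) * (Z x * \<psi> (p x)))"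
    if "r \<in> borel_measurable borel" "\<And>x. 0 \<le> r x" for r
    unfolding expand using int[OF that] by (intro Bochner_Integration.integrable_sum integrable_mult_right)
  have "(\<integral>x. soft_ind k (q x) * (Z x * \<psi> (p x)) \<partial>std_gaussian) = (\<Sum>i\<in>UNIV. \<Sum>j\<in>UNIV - {i}. Q i j * M i j)"
    unfolding expand M_def using int[of q] q_nonneg
    by (simp add: Bochner_Integration.integral_sum)
  also have "\<dots> = 0"
    using QM by (intro sum.neutral ballI) auto
  finally have q0: "(\<integral>x. soft_ind k (q x) * (Z x * \<psi> (p x)) \<partial>std_gaussian) = 0" .
  \<comment> \<open>\<open>d\<close> and \<open>p\<close> are even in each coordinate, whereas
    \<open>x $ i * x $ j\<close> changes sign when the \<open>i\<close>-th coordinate is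
    reflected.\<close>
  have d0': "(\<integral>x. soft_ind k (d x) * (x $ i * x $ j * \<psi> (p x)) \<partial>std_gaussian) = 0" if "i \<noteq> j" for i j
  proof -
    let ?g = "\<lambda>x. soft_ind k (d x) * (x $ i * x $ j * \<psi> (p x))"
    have "(reflect_coord i x $ l)\<^sup>2 = (x $ l)\<^sup>2" for x l
      by (simp add: reflect_coord_def)
    then have "?g (reflect_coord i x) = - ?g x" for x
      using that by (simp add: d_def p_def) (simp add: reflect_coord_def)
    moreover have "(\<integral>x. ?g (reflect_coord i x) \<partial>std_gaussian) = (\<integral>x. ?g x \<partial>std_gaussian)"
      by (rule integral_std_gaussian_orthogonal[OF orthogonal_transformation_reflect_coord]) simp
    ultimately show ?thesis by simp
  qed
  have "(\<integral>x. soft_ind k (d x) * (Z x * \<psi> (p x)) \<partial>std_gaussian) = (\<Sum>i\<in>UNIV. \<Sum>j\<in>UNIV - {i}. Q i j * 0)"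
    unfolding expand using int[of d] d_nonneg
    by (simp add: Bochner_Integration.integral_sum d0')
  then have d0: "(\<integral>x. soft_ind k (d x) * (Z x * \<psi> (p x)) \<partial>std_gaussian) = 0"
    by simp
  txt \<open>Replacing \<open>q = d + Z\<close> by \<open>d\<close> inside the decreasing function \<open>soft_ind k\<close> makes the integrand
    one-signed without changing the integral, which is \<open>0\<close> in both cases.\<close>
  define h where "h = (\<lambda>x. soft_ind k (q x) * (Z x * \<psi> (p x)) - soft_ind k (d x) * (Z x * \<psi> (p x)))"
  have h_eq: "h x = - ((soft_ind k (d x) - soft_ind k (q x)) * Z x * \<psi> (p x))" for x
    by (simp add: h_def algebra_simps)
  \<comment> \<open>Continuity gives vanishing at every point rather than almost everywhere, which
    allows evaluation at a chosen point below.\<close>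
  have h0: "h z = 0" for z
  proof (rule integral_std_gaussian_eq_0_imp[of h])
    show "continuous_on UNIV h"
      unfolding h_def using d_cont Z_cont by (intro continuous_intros)
    show "integrable std_gaussian h"
      unfolding h_def by (intro Bochner_Integration.integrable_diff intZ q_nonneg d_nonneg) simp_all
    show "(\<integral>x. h x \<partial>std_gaussian) = 0"
      unfolding h_def
      by (subst Bochner_Integration.integral_diff) (simp_all add: intZ q_nonneg d_nonneg q0 d0)
    fix x
    show "0 \<le> h x"
    proof -
      have "0 \<le> (soft_ind k (d x) - soft_ind k (q x)) * Z x"
      proof (cases "0 \<le> Z x")
        case True
        then show ?thesis
          using soft_ind_antimono[of "d x" "q x" k] d_nonneg[of x] by (simp add: q_eq)
      next
        case False
        then show ?thesis
          using soft_ind_antimono[of "q x" "d x" k] q_nonneg[of x] by (intro mult_nonpos_nonpos) (auto simp: q_eq)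
      qed
      moreover have "\<psi> (p x) \<le> 0"
        using p_nonneg[of x] by (simp add: \<psi>_def)
      ultimately show ?thesis
        unfolding h_eq by (simp add: mult_nonneg_nonpos)
    qed
  qed
  have Q0: "Q i j = 0" if "i \<noteq> j" for i j
  proof -
    \<comment> \<open>At this point \<open>Z\<close> isolates a single entry,
      \<open>Z x = 2 * Q i j\<close>, and \<open>p x\<close> is positive, so the factor
      \<open>\<psi> (p x)\<close> does not vanish.\<close>
    define x :: "real^'n" where "x = axis i 1 + axis j 1"
    have x: "x $ l = (if l = i \<or> l = j then 1 else 0)" for l
      using that by (auto simp: x_def axis_def)
    have "0 < p x"
      unfolding p_def sum_two_coords[OF that] using a[of i] a[of j]
      by (intro add_pos_nonneg sum_nonneg) (auto simp: x)
    then have "\<psi> (p x) \<noteq> 0"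
      by (simp add: \<psi>_def less_imp_neq[symmetric] soft_ind_def)
    then have "soft_ind k (d x) = soft_ind k (q x) \<or> Z x = 0"
      using h0[of x] by (simp add: h_eq)
    \<comment> \<open>If \<open>Z x\<close> were nonzero, \<open>d x\<close> and \<open>q x\<close>
      would differ, and by strict monotonicity so would their values under
      \<open>soft_ind k\<close>.\<close>
    then have "Z x = 0"
      using soft_ind_strict_antimono[OF k d_nonneg[of x], of "q x"]
        soft_ind_strict_antimono[OF k q_nonneg[of x], of "d x"]
      by (cases "Z x" "0 :: real" rule: linorder_cases) (auto simp: q_eq)
    moreover have "Z x = 2 * Q i j"
    proof -
      have "(\<Sum>m\<in>UNIV - {l}. x $ l * x $ m * Q l m) =
          (if l = i then Q i j else if l = j then Q j i else 0)" for l
      proof -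
        have "(\<Sum>m\<in>UNIV - {i}. x $ i * x $ m * Q i m) = (\<Sum>m\<in>{j}. Q i m)"
          using that by (intro sum.mono_neutral_cong_right) (auto simp: x)
        moreover have "(\<Sum>m\<in>UNIV - {j}. x $ j * x $ m * Q j m) = (\<Sum>m\<in>{i}. Q j m)"
          using that by (intro sum.mono_neutral_cong_right) (auto simp: x)
        ultimately show ?thesis
          by (auto simp: x)
      qed
      then have "Z x = Q i j + Q j i"
        unfolding Z_def sum_two_coords[OF that] using that by simp
      then show ?thesis by (simp add: Q_def inner_commute)
    qed
    ultimately show ?thesis by simp
  qed

  \<comment> \<open>Harris' inequality at the coaxial minimum\<close>
  have q_diag: "q x = (\<Sum>i\<in>UNIV. (norm (column i (T ** U)))\<^sup>2 * (x $ i)\<^sup>2)" for x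
    unfolding q_def by (rule norm_matrix_vector_mult_orthogonal_columns) (use Q0 in \<open>simp add: Q_def\<close>)
  have mono: "(\<Sum>i\<in>UNIV. c i * (x $ i)\<^sup>2) \<le> (\<Sum>i\<in>UNIV. c i * (y $ i)\<^sup>2)"
    if "\<And>i. \<bar>x $ i\<bar> \<le> \<bar>y $ i\<bar>" "\<And>i. 0 \<le> c i" for c and x y :: "real^'n"
    using that by (intro sum_mono mult_left_mono) (auto simp: abs_le_square_iff)
  have harris: "(\<integral>x. soft_ind k (q x) \<partial>std_gaussian) * (\<integral>x. soft_ind k (p x) \<partial>std_gaussian) \<le>
      (\<integral>x. soft_ind k (q x) * soft_ind k (p x) \<partial>std_gaussian)"
  proof (rule std_gaussian_harris[where B = 1 and C = 1])
    show "soft_ind k (q y) \<le> soft_ind k (q x)" if "\<And>i. \<bar>x $ i\<bar> \<le> \<bar>y $ i\<bar>" for x y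
      using that by (intro soft_ind_antimono q_nonneg) (simp add: q_diag mono)
    show "soft_ind k (p y) \<le> soft_ind k (p x)" if "\<And>i. \<bar>x $ i\<bar> \<le> \<bar>y $ i\<bar>" for x y
      using that by (intro soft_ind_antimono p_nonneg) (simp add: p_def mono less_imp_le[OF a])
    show "\<bar>soft_ind k (q x)\<bar> \<le> 1" "\<bar>soft_ind k (p x)\<bar> \<le> 1" for x
      by (simp_all add: q_nonneg p_nonneg)
  qed simp_all
  have orthU: "orthogonal_transformation (\<lambda>x. U *v x)"
    using U_orth by (simp add: orthogonal_transformation_matrix)
  \<comment> \<open>The single integral does not depend on \<open>U\<close>, while the mixed
    integral \<open>f U\<close> is at most its value at \<open>mat 1\<close>, the unrotated
    pair.\<close>
  have "(\<integral>x. soft_ind k (q x) \<partial>std_gaussian) = (\<integral>x. soft_ind k ((norm (T *v (U *v x)))\<^sup>2) \<partial>std_gaussian)"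
    by (simp add: q_def matrix_vector_mul_assoc)
  also have "\<dots> = (\<integral>x. soft_ind k ((norm (T *v x))\<^sup>2) \<partial>std_gaussian)"
    by (rule integral_std_gaussian_orthogonal[OF orthU, of "\<lambda>x. soft_ind k ((norm (T *v x))\<^sup>2)"])
      (intro borel_measurable_continuous_onI continuous_intros)
  finally have "(\<integral>x. soft_ind k ((norm (T *v x))\<^sup>2) \<partial>std_gaussian) * (\<integral>x. soft_ind k (p x) \<partial>std_gaussian) \<le> f U"
    using harris by (simp add: f_def q_def)
  also have "\<dots> \<le> f (mat 1)"
    by (rule U_min) (rule orthogonal_matrix_id)
  finally show ?thesis
    by (simp add: f_def)
qed

section \<open>Arbitrary pairs of ellipsoids and passage to the limit\<close>

lemma borel_measurable_soft_ind_quadratic: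
  "(\<lambda>x. soft_ind k ((norm ((T :: real^'n^'n) *v x))\<^sup>2)) \<in> borel_measurable borel"
  by (intro borel_measurable_continuous_onI continuous_intros)

text \<open>A rotation to the principal axes of the form of \<open>S\<close> makes it diagonal, with
  positive coefficients by invertibility. All three integrals are invariant under this common
  rotation.\<close>

lemma correlation_soft_ind:
  fixes S T :: "real^'n^'n"
  assumes k: "0 < k" and S: "invertible S"
  shows "(\<integral>x. soft_ind k ((norm (T *v x))\<^sup>2) \<partial>std_gaussian) * (\<integral>x. soft_ind k ((norm (S *v x))\<^sup>2) \<partial>std_gaussian)
    \<le> (\<integral>x. soft_ind k ((norm (T *v x))\<^sup>2) * soft_ind k ((norm (S *v x))\<^sup>2) \<partial>std_gaussian)"
proof -
  have "{U :: real^'n^'n. orthogonal_matrix U} \<noteq> {}"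
    using orthogonal_matrix_id by blast
  \<comment> \<open>The set of all orthogonal matrices is stable under every plane rotation, so all
    pairs of columns become orthogonal. This is the spectral theorem for
    \<open>transpose S ** S\<close>.\<close>
  then obtain U where U: "orthogonal_matrix U"
    and orth: "\<And>i j. i \<noteq> j \<Longrightarrow> column i (S ** U) \<bullet> column j (S ** U) = 0"
    using exists_orthogonal_columns[OF compact_orthogonal_matrices, of S]
    by (metis (no_types, lifting) mem_Collect_eq orthogonal_matrix_mul orthogonal_matrix_givens_matrix)
  define a where "a i = (norm (column i (S ** U)))\<^sup>2" for i
  have "0 < a i" for i
  proof -
    have "invertible (S ** U)"
      using S U by (intro invertible_mult) (auto simp: orthogonal_matrix_def invertible_def)
    then have "inj ((*v) (S ** U))"
      by (rule inj_matrix_vector_mult)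
    then have "(S ** U) *v axis i 1 \<noteq> (S ** U) *v 0"
      by (metis axis_eq_0_iff injD zero_neq_one)
    then show ?thesis
      by (simp add: a_def matrix_vector_mult_basis)
  qed
  then have "(\<integral>x. soft_ind k ((norm ((T ** U) *v x))\<^sup>2) \<partial>std_gaussian) *
      (\<integral>x. soft_ind k (\<Sum>i\<in>UNIV. a i * (x $ i)\<^sup>2) \<partial>std_gaussian)
    \<le> (\<integral>x. soft_ind k ((norm ((T ** U) *v x))\<^sup>2) * soft_ind k (\<Sum>i\<in>UNIV. a i * (x $ i)\<^sup>2) \<partial>std_gaussian)"
    by (rule correlation_diagonal[OF k])
  moreover have "(\<Sum>i\<in>UNIV. a i * (x $ i)\<^sup>2) = (norm ((S ** U) *v x))\<^sup>2" for x
    unfolding a_def using orth by (rule norm_matrix_vector_mult_orthogonal_columns[symmetric])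
  ultimately have le: "(\<integral>x. soft_ind k ((norm (T *v (U *v x)))\<^sup>2) \<partial>std_gaussian) *
      (\<integral>x. soft_ind k ((norm (S *v (U *v x)))\<^sup>2) \<partial>std_gaussian)
    \<le> (\<integral>x. soft_ind k ((norm (T *v (U *v x)))\<^sup>2) * soft_ind k ((norm (S *v (U *v x)))\<^sup>2) \<partial>std_gaussian)"
    by (simp add: matrix_vector_mul_assoc)
  have "orthogonal_transformation ((*v) U)"
    using U by (simp add: orthogonal_transformation_matrix)
  note rotate = integral_std_gaussian_orthogonal[OF this]
  note [measurable] = borel_measurable_soft_ind_quadratic
  have "(\<integral>x. soft_ind k ((norm (R *v (U *v x)))\<^sup>2) \<partial>std_gaussian) =
      (\<integral>x. soft_ind k ((norm (R *v x))\<^sup>2) \<partial>std_gaussian)" for R :: "real^'n^'n"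
    by (rule rotate) measurable
  moreover have "(\<integral>x. soft_ind k ((norm (T *v (U *v x)))\<^sup>2) * soft_ind k ((norm (S *v (U *v x)))\<^sup>2) \<partial>std_gaussian) =
      (\<integral>x. soft_ind k ((norm (T *v x))\<^sup>2) * soft_ind k ((norm (S *v x))\<^sup>2) \<partial>std_gaussian)"
    by (rule rotate) measurable
  ultimately show ?thesis
    using le by simp
qed

text \<open>\<open>T\<close> is the matrix of the inverse of the defining map. The sublevel form of
  a quadratic form is the one that \<open>soft_ind\<close> approximates.\<close>

lemma centered_ellipsoidE:
  fixes A :: "(real^'n) set"
  assumes "centered_ellipsoid A"
  obtains T :: "real^'n^'n" where "invertible T" "A = {x. (norm (T *v x))\<^sup>2 \<le> 1}"
proof -
  from assms obtain f :: "real^'n \<Rightarrow> real^'n" where f: "linear f" "bij f" and A: "A = f ` cball 0 1"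
    unfolding centered_ellipsoid_def by blast
  have lin: "linear (inv f)"
    using f by (simp add: bij_is_inj inj_linear_imp_inv_linear)
  have mult: "(*v) (matrix (inv f)) = inv f"
    using lin by (simp add: fun_eq_iff matrix_works)
  show thesis
  proof (rule that)
    show "invertible (matrix (inv f))"
      using f(2) by (simp add: invertible_eq_bij mult bij_imp_bij_inv)
    show "A = {x. (norm (matrix (inv f) *v x))\<^sup>2 \<le> 1}"
      using f(2) by (auto simp: A mult bij_image_Collect_eq abs_square_le_1 cball_def)
  qed
qed

theorem theorem9:
  fixes A B :: "(real ^ 'n) set"
  assumes "centered_ellipsoid A" and "centered_ellipsoid B"
  shows "measure std_gaussian (A \<inter> B) \<ge> measure std_gaussian A * measure std_gaussian B"
proof -
  interpret prob_space "std_gaussian :: (real^'n) measure"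
    by (rule prob_space_std_gaussian)
  obtain T :: "real^'n^'n" where A: "A = {x. (norm (T *v x))\<^sup>2 \<le> 1}"
    using assms(1) by (rule centered_ellipsoidE)
  obtain S :: "real^'n^'n" where S: "invertible S" and B: "B = {x. (norm (S *v x))\<^sup>2 \<le> 1}"
    using assms(2) by (rule centered_ellipsoidE)
  \<comment> \<open>Smooth approximations of the indicators; \<open>Suc k\<close> keeps the
    parameter positive, as \<open>correlation_soft_ind\<close> requires.\<close>
  define \<phi> where "\<phi> R k x = soft_ind (Suc k) ((norm (R *v x))\<^sup>2)" for R :: "real^'n^'n" and k x
  have meas: "\<phi> R k \<in> borel_measurable borel" for R k
    unfolding \<phi>_def by (rule borel_measurable_soft_ind_quadratic)
  have bd: "\<bar>\<phi> R k x\<bar> \<le> 1" for R k x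
    by (simp add: \<phi>_def)
  have ell: "{x. (norm (R *v x))\<^sup>2 \<le> 1} \<in> sets borel" for R :: "real^'n^'n"
    by (intro borel_closed closed_Collect_le continuous_intros)
  have lim: "(\<lambda>k. \<phi> R k x) \<longlonglongrightarrow> indicator {x. (norm (R *v x))\<^sup>2 \<le> 1} x" for R x
    using soft_ind_tendsto[of "(norm (R *v x))\<^sup>2"] by (auto simp: \<phi>_def indicator_def)
  have lim1: "(\<lambda>k. \<integral>x. \<phi> R k x \<partial>std_gaussian) \<longlonglongrightarrow> measure std_gaussian {x. (norm (R *v x))\<^sup>2 \<le> 1}" for R
  proof -
    have "(\<lambda>k. \<integral>x. \<phi> R k x \<partial>std_gaussian) \<longlonglongrightarrow> (\<integral>x. indicator {x. (norm (R *v x))\<^sup>2 \<le> 1} x \<partial>std_gaussian)"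
      by (rule integral_dominated_convergence[where w = "\<lambda>_. 1"])
        (use meas bd lim ell in \<open>auto simp: borel_measurable_std_gaussian_iff\<close>)
    then show ?thesis by simp
  qed
  have lim2: "(\<lambda>k. \<integral>x. \<phi> T k x * \<phi> S k x \<partial>std_gaussian) \<longlonglongrightarrow> measure std_gaussian (A \<inter> B)"
  proof -
    have "(\<lambda>k. \<integral>x. \<phi> T k x * \<phi> S k x \<partial>std_gaussian) \<longlonglongrightarrow> (\<integral>x. indicator A x * indicator B x \<partial>std_gaussian)"
    proof (rule integral_dominated_convergence[where w = "\<lambda>_. 1"])
      show "AE x in std_gaussian. (\<lambda>k. \<phi> T k x * \<phi> S k x) \<longlonglongrightarrow> indicator A x * indicator B x"
        unfolding A B by (intro always_eventually allI tendsto_mult lim)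
      show "AE x in std_gaussian. norm (\<phi> T k x * \<phi> S k x) \<le> 1" for k
        using bd by (simp add: abs_mult mult_le_one)
    qed (use meas ell in \<open>auto simp: borel_measurable_std_gaussian_iff A B\<close>)
    then show ?thesis
      by (simp flip: indicator_inter_arith)
  qed
  show ?thesis
  proof (rule LIMSEQ_le)
    show "(\<lambda>k. (\<integral>x. \<phi> T k x \<partial>std_gaussian) * (\<integral>x. \<phi> S k x \<partial>std_gaussian))
        \<longlonglongrightarrow> measure std_gaussian A * measure std_gaussian B"
      unfolding A B by (intro tendsto_mult lim1)
    show "\<exists>N. \<forall>k\<ge>N. (\<integral>x. \<phi> T k x \<partial>std_gaussian) * (\<integral>x. \<phi> S k x \<partial>std_gaussian) \<le>
        (\<integral>x. \<phi> T k x * \<phi> S k x \<partial>std_gaussian)"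
      unfolding \<phi>_def using correlation_soft_ind[OF _ S] by simp
  qed (rule lim2)
qed

end
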